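(* Let $E/\mathbb{Q}$ be an elliptic curve and let $n = pq$, with $p < q$ primes and $n$ coprime to $2$ and $3$, be an elliptic Korselt number of Type I for $E$. Then at least one of the following conditions holds: (1) $p \le 13$; (2) $p$ and $q$ are both anomalous for $E$; (3) $p \ge \dfrac{\sqrt{q}}{16}$.
   Context: For an elliptic curve $E/\mathbb{Q}$ (given by a minimal Weierstrass equation) and a prime $p$ of good reduction, $a_p = p + 1 - \#E(\mathbb{F}_p)$. For a positive integer $n$, $a_n$ is the $n$-th coefficient of the $L$-series $L(E/\mathbb{Q},s) = \sum_{n\ge1} a_n n^{-s}$; in particular $a_{pq} = a_p a_q$ for distinct primes $p,q$. $\operatorname{ord}_p(k)$ is the exponent of $p$ in $k$, with $\operatorname{ord}_p(0) = \infty$. A positive integer $n$ is an elliptic Korselt number of Type I for $E$ if $n$ has at least two distinct prime factors and for every prime $p$ dividing $n$: (i) $E$ has good reduction at $p$; (ii) $p + 1 - a_p$ divides $n + 1 - a_n$; (iii) $\operatorname{ord}_p(a_n - 1) \ge \operatorname{ord}_p(n) - \delta_p$, where $\delta_p = 1$ if $a_p \not\equiv 1 \pmod p$ and $\delta_p = 0$ if $a_p \equiv 1 \pmod p$. A prime $p$ is anomalous for $E$ if $E$ has good reduction at $p$ and $\#E(\mathbb{F}_p) = p$, equivalently $a_p = 1$. *)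

theory Defs
  imports
    Complex_Main
    "HOL-Library.Extended_Nat"
    "HOL-Computational_Algebra.Computational_Algebra"
    "HOL-Number_Theory.Number_Theory"
begin

section \<open>Weierstrass equations\<close>

text \<open>
  The equation $y^2 + a_1 xy + a_3 y = x^3 + a_2 x^2 + a_4 x + a_6$; as usual there is no $a_5$.
\<close>

datatype 'a weierstrass = Weierstrass (A1: 'a) (A2: 'a) (A3: 'a) (A4: 'a) (A6: 'a)

definition weierstrass_poly :: "'a::comm_ring_1 weierstrass \<Rightarrow> 'a \<Rightarrow> 'a \<Rightarrow> 'a" where
  "weierstrass_poly E x y =
     y^2 + A1 E * x * y + A3 E * y - (x^3 + A2 E * x^2 + A4 E * x + A6 E)"

definition weierstrass_poly_dx :: "'a::comm_ring_1 weierstrass \<Rightarrow> 'a \<Rightarrow> 'a \<Rightarrow> 'a" where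
  "weierstrass_poly_dx E x y = A1 E * y - (3 * x^2 + 2 * A2 E * x + A4 E)"

definition weierstrass_poly_dy :: "'a::comm_ring_1 weierstrass \<Rightarrow> 'a \<Rightarrow> 'a \<Rightarrow> 'a" where
  "weierstrass_poly_dy E x y = 2 * y + A1 E * x + A3 E"

definition discriminant :: "'a::comm_ring_1 weierstrass \<Rightarrow> 'a" where
  "discriminant E =
     (let b2 = A1 E ^ 2 + 4 * A2 E;
          b4 = 2 * A4 E + A1 E * A3 E;
          b6 = A3 E ^ 2 + 4 * A6 E;
          b8 = A1 E ^ 2 * A6 E + 4 * A2 E * A6 E - A1 E * A3 E * A4 E + A2 E * A3 E ^ 2 - A4 E ^ 2
      in - (b2^2 * b8) - 8 * b4^3 - 27 * b6^2 + 9 * b2 * b4 * b6)"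

text \<open>
  The equation in $x', y'$ obtained by substituting $x = u^2 x' + r$ and
  $y = u^3 y' + u^2 s x' + t$ and dividing by $u^6$.
\<close>

definition change_coordinates ::
    "'a \<Rightarrow> 'a \<Rightarrow> 'a \<Rightarrow> 'a \<Rightarrow> 'a::field weierstrass \<Rightarrow> 'a weierstrass" where
  "change_coordinates u r s t E = Weierstrass
     ((A1 E + 2 * s) / u)
     ((A2 E - s * A1 E + 3 * r - s^2) / u^2)
     ((A3 E + r * A1 E + 2 * t) / u^3)
     ((A4 E - s * A3 E + 2 * r * A2 E - (t + r * s) * A1 E + 3 * r^2 - 2 * s * t) / u^4)
     ((A6 E + r * A4 E + r^2 * A2 E + r^3 - t * A3 E - t^2 - r * t * A1 E) / u^6)"

definition p_integral :: "nat \<Rightarrow> rat \<Rightarrow> bool" where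
  "p_integral p x \<longleftrightarrow> \<not> int p dvd snd (quotient_of x)"

text \<open>The $p$-adic valuation of a nonzero rational number.\<close>

definition rat_valuation :: "nat \<Rightarrow> rat \<Rightarrow> int" where
  "rat_valuation p x =
     int (multiplicity (int p) (fst (quotient_of x))) - int (multiplicity (int p) (snd (quotient_of x)))"

definition minimal_at :: "nat \<Rightarrow> rat weierstrass \<Rightarrow> bool" where
  "minimal_at p E \<longleftrightarrow>
     (\<forall>a\<in>set_weierstrass E. p_integral p a) \<and>
     (\<forall>u r s t. u \<noteq> 0 \<longrightarrow>
        (\<forall>a\<in>set_weierstrass (change_coordinates u r s t E). p_integral p a) \<longrightarrow>
        rat_valuation p (discriminant E)
          \<le> rat_valuation p (discriminant (change_coordinates u r s t E)))"

text \<open>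
  Every elliptic curve over the rationals has a model with integral coefficients that is
  minimal at all primes simultaneously, so elliptic curves over the rationals are given here
  by integral Weierstrass equations satisfying this predicate.
\<close>

definition minimal_elliptic_curve :: "int weierstrass \<Rightarrow> bool" where
  "minimal_elliptic_curve E \<longleftrightarrow>
     discriminant E \<noteq> 0 \<and> (\<forall>p. prime p \<longrightarrow> minimal_at p (map_weierstrass of_int E))"


section \<open>Reduction modulo a prime\<close>

text \<open>
  The field with $p$ elements is represented by the residues \<open>{0..<int p}\<close>. All notions in this
  section refer to the reduction of the given equation, which is meant to be a minimal one.
\<close>

definition good_reduction :: "int weierstrass \<Rightarrow> nat \<Rightarrow> bool" where
  "good_reduction E p \<longleftrightarrow> \<not> int p dvd discriminant E"

definition affine_points :: "int weierstrass \<Rightarrow> nat \<Rightarrow> (int \<times> int) set" where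
  "affine_points E p =
     {(x, y). x \<in> {0..<int p} \<and> y \<in> {0..<int p} \<and> [weierstrass_poly E x y = 0] (mod int p)}"

text \<open>The additional point is the point at infinity.\<close>

definition num_points :: "int weierstrass \<Rightarrow> nat \<Rightarrow> nat" where
  "num_points E p = card (affine_points E p) + 1"

definition frobenius_trace :: "int weierstrass \<Rightarrow> nat \<Rightarrow> int" where
  "frobenius_trace E p = int p + 1 - int (num_points E p)"

definition singular_points :: "int weierstrass \<Rightarrow> nat \<Rightarrow> (int \<times> int) set" where
  "singular_points E p = {(x, y) \<in> affine_points E p.
     [weierstrass_poly_dx E x y = 0] (mod int p) \<and> [weierstrass_poly_dy E x y = 0] (mod int p)}"

text \<open>
  At a singular point $(x_0, y_0)$ the equation becomes
  $Y^2 + a_1 XY - (3 x_0 + a_2) X^2 = X^3$ with $X = x - x_0$ and $Y = y - y_0$, so the slopes of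
  the tangent lines are the roots of $m^2 + a_1 m - (3 x_0 + a_2)$. These are two rational slopes
  for split multiplicative reduction and two conjugate irrational ones for nonsplit
  multiplicative reduction; for additive reduction there is a single slope, which is rational.
\<close>

definition tangent_slopes :: "int weierstrass \<Rightarrow> nat \<Rightarrow> int \<Rightarrow> int set" where
  "tangent_slopes E p x0 =
     {m \<in> {0..<int p}. [m^2 + A1 E * m - (3 * x0 + A2 E) = 0] (mod int p)}"

definition split_multiplicative :: "int weierstrass \<Rightarrow> nat \<Rightarrow> bool" where
  "split_multiplicative E p \<longleftrightarrow>
     (\<exists>(x0, y0) \<in> singular_points E p. card (tangent_slopes E p x0) = 2)"

definition nonsplit_multiplicative :: "int weierstrass \<Rightarrow> nat \<Rightarrow> bool" where
  "nonsplit_multiplicative E p \<longleftrightarrow>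
     (\<exists>(x0, y0) \<in> singular_points E p. tangent_slopes E p x0 = {})"

definition anomalous :: "int weierstrass \<Rightarrow> nat \<Rightarrow> bool" where
  "anomalous E p \<longleftrightarrow> good_reduction E p \<and> num_points E p = p"


section \<open>The coefficients of the L-series\<close>

text \<open>
  The polynomial $L_p(T)$ with $L(E,s) = \prod_p L_p(p^{-s})^{-1}$.
\<close>

definition local_factor :: "int weierstrass \<Rightarrow> nat \<Rightarrow> int fps" where
  "local_factor E p =
     (if good_reduction E p then
        1 - fps_const (frobenius_trace E p) * fps_X + fps_const (int p) * fps_X ^ 2
      else if split_multiplicative E p then 1 - fps_X
      else if nonsplit_multiplicative E p then 1 + fps_X
      else 1)"

text \<open>
  Expanding the Euler product, $a_n$ for positive $n$ is the product, over the primes $p$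
  dividing $n$ with exponent $k$, of the coefficient of $T^k$ in $L_p(T)^{-1}$. The second argument
  of \<^const>\<open>fps_right_inverse\<close> is the inverse of the constant coefficient
  (\<^const>\<open>inverse\<close> is not available for power series over the integers).
\<close>

definition lseries_coeff :: "int weierstrass \<Rightarrow> nat \<Rightarrow> int" where
  "lseries_coeff E n =
     (\<Prod>p\<in>prime_factors n. fps_nth (fps_right_inverse (local_factor E p) 1) (multiplicity p n))"

lemma local_factor_inverse: "local_factor E p * fps_right_inverse (local_factor E p) 1 = 1"
  by (rule fps_right_inverse) (simp add: local_factor_def)

lemma lseries_coeff_prime:
  assumes "prime p" "good_reduction E p"
  shows "lseries_coeff E p = frobenius_trace E p"
proof -
  have "prime_factors p = {p}" "multiplicity p p = 1"
    using assms(1) by (auto simp: prime_factorization_prime)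
  moreover have "fps_nth (fps_right_inverse (local_factor E p) 1) 1 = frobenius_trace E p"
  proof -
    let ?f = "local_factor E p" and ?g = "fps_right_inverse (local_factor E p) 1"
    have f: "fps_nth ?f 0 = 1" "fps_nth ?f 1 = - frobenius_trace E p"
      using assms(2) by (simp_all add: local_factor_def)
    have "fps_nth (?f * ?g) 0 = 1" "fps_nth (?f * ?g) 1 = 0"
      by (simp_all add: local_factor_inverse)
    then show ?thesis
      using f by (simp add: fps_mult_nth)
  qed
  ultimately show ?thesis
    by (simp add: lseries_coeff_def)
qed

lemma lseries_coeff_mult:
  assumes "coprime m n" "m > 0" "n > 0"
  shows "lseries_coeff E (m * n) = lseries_coeff E m * lseries_coeff E n"
proof -
  let ?c = "\<lambda>p k. fps_nth (fps_right_inverse (local_factor E p) 1) k"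
  have disj: "prime_factors m \<inter> prime_factors n = {}"
    using assms(1) by (metis disjoint_iff in_prime_factors_iff coprime_common_divisor not_prime_unit)
  have mult: "multiplicity p (m * n) = multiplicity p m + multiplicity p n" if "prime p" for p
    using that assms(2,3) by (intro prime_elem_multiplicity_mult_distrib) auto
  have m: "?c p (multiplicity p (m * n)) = ?c p (multiplicity p m)" if "p \<in> prime_factors m" for p
  proof -
    have "prime p" "\<not> p dvd n"
      using that disj assms(3) by (auto simp: prime_factors_dvd)
    then show ?thesis by (simp add: mult not_dvd_imp_multiplicity_0)
  qed
  have n: "?c p (multiplicity p (m * n)) = ?c p (multiplicity p n)" if "p \<in> prime_factors n" for p
  proof -
    have "prime p" "\<not> p dvd m"
      using that disj assms(2) by (auto simp: prime_factors_dvd)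
    then show ?thesis by (simp add: mult not_dvd_imp_multiplicity_0)
  qed
  have "prime_factors (m * n) = prime_factors m \<union> prime_factors n"
    using assms(2,3) by (simp add: prime_factors_product)
  then show ?thesis
    using disj m n by (simp add: lseries_coeff_def prod.union_disjoint)
qed


section \<open>Elliptic Korselt numbers\<close>

definition ord_at :: "nat \<Rightarrow> int \<Rightarrow> enat" where
  "ord_at p k = (if k = 0 then \<infinity> else enat (multiplicity (int p) k))"

definition korselt_delta :: "int weierstrass \<Rightarrow> nat \<Rightarrow> enat" where
  "korselt_delta E p = (if [frobenius_trace E p = 1] (mod int p) then 0 else 1)"

text \<open>
  Subtraction does not truncate here: $\mathrm{ord}_p(n)$ is at least 1 since $p$ divides $n$.
\<close>

definition elliptic_korselt_type_I :: "int weierstrass \<Rightarrow> nat \<Rightarrow> bool" where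
  "elliptic_korselt_type_I E n \<longleftrightarrow>
     n > 0 \<and> card (prime_factors n) \<ge> 2 \<and>
     (\<forall>p. prime p \<longrightarrow> p dvd n \<longrightarrow>
        good_reduction E p \<and>
        (int p + 1 - frobenius_trace E p) dvd (int n + 1 - lseries_coeff E n) \<and>
        ord_at p (lseries_coeff E n - 1) \<ge> ord_at p (int n) - korselt_delta E p)"

end

theory Submission
  imports Defs "Berlekamp_Zassenhaus.Finite_Field"
begin

text \<open>
  Write $N_r = \#E(\mathbb{F}_r)$. Since $q \equiv a_q - 1$ modulo $N_q = q + 1 - a_q$, the Korselt
  condition at $q$ says that $N_q$ divides $M = a_q (p - a_p) - (p - 1)$. By Hasse's bound $M$ has
  size about $2 p \sqrt q$ while $N_q$ has size about $q$. So if $q > 256 p^2$, then $M = 0$, that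
  is, $a_q (p - a_p) = p - 1$. Here $a_q = 1$ gives $a_p = 1$, and both primes are anomalous. If
  $a_q \ge 2$, then $2 a_p \ge p + 1$, which contradicts Hasse's bound once $p > 13$. Thus the
  corollary rests on Hasse's bound, in the form $a_p^2 \le 4 p + 1$
  (\<open>frobenius_trace_bound\<close>).

  The bound is proved by Manin's elementary method. On the quadratic twist $f(t) y^2 = f(x)$ of the
  curve $y^2 = f(x) = x^3 + A x + B$ over $\mathbb{F}_q(t)$ consider the points
  $P_n = P_0 \pm n Q$, for a fixed sign, with $Q = (t, 1)$ and $P_0 = (t^q, f(t)^{(q-1)/2})$.
  Let $d_n$ be the degree of the numerator of the $x$-coordinate of $P_n$. The second differences
  of $d_n$ are at most 2, and $d_0 = q$, $d_1 \le q + 1 \pm a$. Hence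
  $0 \le d_n \le n^2 \pm a n + q$ for $n \ge 0$. With both signs, $n^2 + a n + q$ is nonnegative at
  all integers $n$, so its discriminant $a^2 - 4 q$ is at most 1.

  The sequence is built from $x$-coordinates alone. Those of $P + Q$ and $P - Q$ are the roots of a
  quadratic polynomial whose coefficients depend only on the $x$-coordinates of $P$ and $Q$, so
  from two successive members of the sequence the next one is
  found as the second root of that polynomial (\<open>adjacent_step\<close>).
\<close>

section \<open>Sum and difference with a fixed point, in terms of x-coordinates\<close>

text \<open>
  Let $P$ and $Q$ be points of $y^2 = x^3 + a x + b$ (or of a twist) with $x$-coordinates $F / G$
  and $t$. Then the $x$-coordinates of $P + Q$ and $P - Q$ are the roots $X$ of
  $w X^2 - v X + u$, where $w$, $v$, $u$ are the following three values.
\<close>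

definition quad_lead :: "'r::comm_ring_1 \<Rightarrow> 'r \<Rightarrow> 'r \<Rightarrow> 'r" where
  "quad_lead t F G = (F - t * G)^2"
definition quad_mid :: "'r::comm_ring_1 \<Rightarrow> 'r \<Rightarrow> 'r \<Rightarrow> 'r \<Rightarrow> 'r \<Rightarrow> 'r" where
  "quad_mid a b t F G = 2 * ((F + t * G) * (F * t + a * G) + 2 * b * G^2)"
definition quad_const :: "'r::comm_ring_1 \<Rightarrow> 'r \<Rightarrow> 'r \<Rightarrow> 'r \<Rightarrow> 'r \<Rightarrow> 'r" where
  "quad_const a b t F G = (F * t - a * G)^2 - 4 * b * G * (F + t * G)"

text \<open>
  The fractions $F / G$ and $F' / G'$ are related like the $x$-coordinates of two points that differ
  by $\pm Q$, where $Q$ has $x$-coordinate $t = $ \<open>[:0, 1:]\<close>. Numerator and denominator are kept as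
  separate arguments so that the point at infinity, $1 / 0$, is not special.
\<close>

definition adjacent :: "'a::comm_ring_1 \<Rightarrow> 'a \<Rightarrow> 'a poly \<Rightarrow> 'a poly \<Rightarrow> 'a poly \<Rightarrow> 'a poly \<Rightarrow> bool" where
  "adjacent A B F G F' G' \<longleftrightarrow>
     quad_lead [:0,1:] F G * F'^2 - quad_mid [:A:] [:B:] [:0,1:] F G * F' * G' + quad_const [:A:] [:B:] [:0,1:] F G * G'^2 = 0"

text \<open>
  The relation only says that the two points differ by $\pm Q$, which is symmetric. This is what
  allows the chain below to continue: each member serves as a known root of the quadratic of its
  successor.
\<close>

lemma adjacent_sym: "adjacent A B F G F' G' \<longleftrightarrow> adjacent A B F' G' F G"
proof -
  have "quad_lead t F G * F'^2 - quad_mid a b t F G * F' * G' + quad_const a b t F G * G'^2 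
     = quad_lead t F' G' * F^2 - quad_mid a b t F' G' * F * G + quad_const a b t F' G' * G^2" for a b t :: "'a poly"
    unfolding quad_lead_def quad_mid_def quad_const_def by (simp add: algebra_simps power2_eq_square)
  then show ?thesis by (simp add: adjacent_def)
qed

text \<open>
  A fraction in lowest terms, regarded as a function of $t$, with a pole at infinity. The case
  $G = 0$ is the constant $\infty$. The degree of $F$ is then the height of the fraction.
\<close>

definition pole_pair :: "'a::field_gcd poly \<Rightarrow> 'a poly \<Rightarrow> bool" where
  "pole_pair F G \<longleftrightarrow> coprime F G \<and> F \<noteq> 0 \<and> (G = 0 \<or> degree G < degree F)"

text \<open>
  Cancelling the greatest common divisor. The last conclusion is how a common divisor that is known
  explicitly bounds the height of the reduced fraction.
\<close>

lemma reduce_pair: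
  fixes F G :: "'a::field_gcd poly"
  assumes "F \<noteq> 0" "G = 0 \<or> degree G < degree F"
  obtains g F' G' where "F = g * F'" "G = g * G'" "g \<noteq> 0" "pole_pair F' G'"
    "\<And>c. c dvd F \<Longrightarrow> c dvd G \<Longrightarrow> degree F' + degree c \<le> degree F"
proof -
  obtain F' G' where *: "F = gcd F G * F'" "G = gcd F G * G'" "coprime F' G'"
    using assms(1) gcd_coprime_exists[of F G] by (metis gcd_eq_0_iff mult.commute)
  define g where "g = gcd F G"
  note * = *[folded g_def]
  have nz: "g \<noteq> 0" "F' \<noteq> 0" using * assms(1) by auto
  have dF: "degree F = degree g + degree F'"
    using nz *(1) by (metis degree_mult_eq)
  have "G' = 0 \<or> degree G' < degree F'"
  proof (cases "G' = 0")
    case False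
    then have "degree G = degree g + degree G'" "G \<noteq> 0"
      using nz *(2) by (metis degree_mult_eq, metis mult_eq_0_iff)
    then show ?thesis using dF assms(2) by auto
  qed simp
  moreover have "degree F' + degree c \<le> degree F" if "c dvd F" "c dvd G" for c
  proof -
    have "c dvd g" using that by (simp add: g_def)
    then show ?thesis using dF nz dvd_imp_degree_le[of c g] by auto
  qed
  ultimately show ?thesis
    using that[of g F' G'] * nz by (auto simp: pole_pair_def)
qed

text \<open>
  The pole makes $(F t)^2$ dominate all other terms.
\<close>

lemma degree_quad_const:
  fixes F G :: "'a::field_gcd poly"
  assumes "pole_pair F G"
  shows "degree (quad_const [:A:] [:B:] [:0,1:] F G) = 2 * degree F + 2"
proof -
  let ?t = "[:0,1:] :: 'a poly"
  define R where "R = [:A:]^2 * G^2 - 2 * [:A:] * F * ?t * G - 4 * [:B:] * G * (F + ?t * G)"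
  have eq: "quad_const [:A:] [:B:] ?t F G = (F * ?t)^2 + R"
    unfolding quad_const_def R_def by Groebner_Basis.algebra
  have lead: "degree ((F * ?t)^2) = 2 * degree F + 2"
    using assms by (simp add: pole_pair_def degree_power_eq degree_mult_eq)
  show ?thesis
  proof (cases "G = 0")
    case True
    then show ?thesis using eq lead by (simp add: R_def)
  next
    case False
    then have d: "Suc (degree G) \<le> degree F" using assms by (auto simp: pole_pair_def)
    let ?n = "2 * degree F + 1"
    have tG: "degree (?t * G) \<le> degree F"
      using d False by (simp add: degree_mult_eq)
    have "degree ([:A:]^2 * G^2) \<le> ?n"
      using d False by (cases "A = 0") (auto simp: degree_mult_eq degree_power_eq)
    moreover have "degree (2 * [:A:] * F * ?t * G) \<le> ?n"
    proof -
      have "2 * [:A:] * F * ?t * G = Polynomial.smult (2 * A) (F * (?t * G))"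
        by (simp add: numeral_poly mult_ac)
      then show ?thesis
        using degree_smult_le[of "2*A" "F * (?t * G)"] degree_mult_le[of F "?t * G"] tG by simp
    qed
    moreover have "degree (4 * [:B:] * G * (F + ?t * G)) \<le> ?n"
    proof -
      have "4 * [:B:] * G * (F + ?t * G) = Polynomial.smult (4 * B) (G * (F + ?t * G))"
        by (simp add: numeral_poly mult_ac)
      moreover have "degree (F + ?t * G) \<le> degree F"
        using tG by (intro degree_add_le) auto
      ultimately show ?thesis
        using degree_smult_le[of "4*B" "G * (F + ?t * G)"] degree_mult_le[of G "F + ?t * G"] d by simp
    qed
    ultimately have "degree R \<le> ?n"
      unfolding R_def by (intro degree_diff_le)
    then show ?thesis
      using eq lead by (simp add: degree_add_eq_left)
  qed
qed

lemma degree_quad_mid: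
  fixes F G :: "'a::field_gcd poly"
  assumes "pole_pair F G"
  shows "degree (quad_mid [:A:] [:B:] [:0,1:] F G) \<le> 2 * degree F + 1"
proof -
  let ?t = "[:0,1:] :: 'a poly"
  have G: "degree G \<le> degree F" and tG: "degree (?t * G) \<le> degree F"
    using assms by (cases "G = 0"; auto simp: pole_pair_def degree_mult_eq)+
  have "degree (F + ?t * G) \<le> degree F"
    using tG by (intro degree_add_le) auto
  moreover have "degree (F * ?t + [:A:] * G) \<le> degree F + 1"
    using G degree_smult_le[of A G] degree_mult_le[of F ?t]
    by (intro degree_add_le) auto
  ultimately have "degree ((F + ?t * G) * (F * ?t + [:A:] * G)) \<le> 2 * degree F + 1"
    using degree_mult_le[of "F + ?t * G" "F * ?t + [:A:] * G"] by linarith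
  moreover have "degree (2 * [:B:] * G^2) \<le> 2 * degree F + 1"
  proof -
    have "2 * [:B:] * G^2 = Polynomial.smult (2 * B) (G^2)" by (simp add: numeral_poly mult.commute)
    then show ?thesis
      using degree_smult_le[of "2*B" "G^2"] degree_power_le[of G 2] G by simp
  qed
  ultimately have "degree ((F + ?t * G) * (F * ?t + [:A:] * G) + 2 * [:B:] * G^2) \<le> 2 * degree F + 1"
    by (intro degree_add_le)
  then show ?thesis
    unfolding quad_mid_def using degree_smult_le[of 2 "(F + ?t * G) * (F * ?t + [:A:] * G) + 2 * [:B:] * G^2"]
    by (simp add: numeral_poly mult.commute)
qed

lemma adjacent_scale:
  fixes F G :: "'a::idom poly"
  assumes "c \<noteq> 0"
  shows "adjacent A B F G (c * F') (c * G') \<longleftrightarrow> adjacent A B F G F' G'"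
proof -
  have "w * (c * F')^2 - v * (c * F') * (c * G') + u * (c * G')^2 = c^2 * (w * F'^2 - v * F' * G' + u * G'^2)"
    for u v w :: "'a poly" by Groebner_Basis.algebra
  then show ?thesis using assms by (simp add: adjacent_def)
qed

text \<open>
  Gauss's lemma for a quadratic form with the primitive linear factor $G X - F Y$: the cofactor
  $r X - s Y$ has coefficients in the ring itself and not only in its field of fractions. For
  $G = 0$, where $F$ is a unit, the middle coefficient determines $r$.
\<close>

lemma other_root:
  fixes F G :: "'r::{idom,semiring_gcd}"
  assumes "coprime F G" "F \<noteq> 0" and root: "w * F^2 - v * F * G + u * G^2 = 0"
  obtains r s where "w = G * r" "v = F * r + G * s" "u = F * s"
proof -
  have "F dvd u * G^2"
  proof -
    have "u * G^2 = F * (v * G - w * F)" using root by Groebner_Basis.algebra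
    then show ?thesis by (metis dvd_triv_left)
  qed
  then have "F dvd u" using assms(1) by (simp add: coprime_dvd_mult_left_iff)
  then obtain s where s: "u = F * s" by blast
  have "w * F^2 - v * F * G + F * s * G^2 = F * (w * F - v * G + s * G^2)" by Groebner_Basis.algebra
  then have e: "w * F - v * G + s * G^2 = 0" using root s assms(2) by simp
  then have "w * F = G * (v - s * G)" by Groebner_Basis.algebra
  then have "G dvd w * F" by (metis dvd_triv_left)
  moreover have "coprime G F" using assms(1) by (simp add: coprime_commute)
  ultimately have "G dvd w" by (simp add: coprime_dvd_mult_left_iff)
  then obtain r0 where r0: "w = G * r0" by blast
  show ?thesis
  proof (cases "G = 0")
    case True
    then have "F dvd 1" using assms(1) by simp
    then obtain k where "1 = F * k" by blast
    then show ?thesis using that[of "k * v" s] s r0 True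
      by (metis add.right_neutral mult.assoc mult.left_neutral mult_zero_left)
  next
    case False
    have "G * (r0 * F - v + s * G) = 0" using e r0 by Groebner_Basis.algebra
    then have "r0 * F - v + s * G = 0" using False by simp
    then have "v = F * r0 + G * s" by (simp add: algebra_simps)
    then show ?thesis using that[of r0 s] s r0 by simp
  qed
qed

text \<open>
  The product of the two roots has numerator \<^const>\<open>quad_const\<close>, of degree $2 \deg F + 2$, and
  cancelling common factors can only lower the degree of the new numerator. The second root again
  has a pole at infinity: otherwise the middle coefficient, whose degree is at most $2 \deg F + 1$,
  would have at least the degree of the constant coefficient.
\<close>

lemma adjacent_step:
  fixes F G F' G' :: "'a::field_gcd poly"
  assumes P: "pole_pair F G" and P': "pole_pair F' G'" and adj: "adjacent A B F G F' G'"
  obtains F'' G'' where "pole_pair F'' G''" "adjacent A B F'' G'' F G"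
    "degree F'' + degree F' \<le> 2 * degree F + 2"
proof -
  let ?U = "quad_const [:A:] [:B:] [:0,1:] F G" and ?V = "quad_mid [:A:] [:B:] [:0,1:] F G" and ?W = "quad_lead [:0,1:] F G"
  obtain r s where W: "?W = G' * r" and V: "?V = F' * r + G' * s" and U: "?U = F' * s"
    using other_root[of F' G' ?W ?V ?U] P' adj unfolding pole_pair_def adjacent_def by metis
  have dU: "degree ?U = 2 * degree F + 2" using degree_quad_const[OF P] .
  have s0: "s \<noteq> 0" using U dU by auto
  have F'0: "F' \<noteq> 0" using P' by (simp add: pole_pair_def)
  have ds: "degree F' + degree s = 2 * degree F + 2" using U dU s0 F'0 by (simp add: degree_mult_eq)
  have deg: "r = 0 \<or> degree r < degree s"
  proof (rule ccontr)
    assume "\<not> ?thesis"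
    then have r: "r \<noteq> 0" "degree s \<le> degree r" by auto
    have "degree ?V = degree F' + degree r"
    proof (cases "G' = 0")
      case True
      then show ?thesis using V r F'0 by (simp add: degree_mult_eq)
    next
      case False
      then have "degree (G' * s) < degree (F' * r)"
        using P' r s0 F'0 by (auto simp: degree_mult_eq pole_pair_def)
      then show ?thesis using V r F'0 by (simp add: degree_add_eq_left degree_mult_eq)
    qed
    then show False using degree_quad_mid[OF P, of A B] r ds by linarith
  qed
  have "adjacent A B F G s r"
    unfolding adjacent_def W V U by Groebner_Basis.algebra
  moreover obtain g F'' G'' where red: "s = g * F''" "r = g * G''" "g \<noteq> 0" "pole_pair F'' G''"
      "\<And>c. c dvd s \<Longrightarrow> c dvd r \<Longrightarrow> degree F'' + degree c \<le> degree s"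
    using reduce_pair[OF s0 deg] by metis
  ultimately have "adjacent A B F'' G'' F G"
    by (metis adjacent_scale adjacent_sym)
  moreover have "degree F'' \<le> degree s" using red(5)[of 1] by simp
  ultimately show ?thesis using that red(4) ds by auto
qed

text \<open>
  By \<open>adjacent_step\<close> the degrees of the numerators along the chain have second differences at
  most 2, so the right-hand side bounds the degree of the $n$-th numerator from above.
\<close>

lemma adjacent_chain:
  fixes F0 G0 F1 G1 :: "'a::field_gcd poly"
  assumes P0: "pole_pair F0 G0" and P1: "pole_pair F1 G1" and adj: "adjacent A B F1 G1 F0 G0"
  defines "c \<equiv> int (degree F1) - int (degree F0) - 1"
  shows "0 \<le> int n ^ 2 + c * int n + int (degree F0)"
proof -
  have "\<exists>F G F' G'. pole_pair F G \<and> pole_pair F' G' \<and> adjacent A B F' G' F G \<and>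
     int (degree F') - int (degree F) \<le> 2 * int n + 1 + c \<and>
     int (degree F) \<le> int n ^ 2 + c * int n + int (degree F0)"
  proof (induction n)
    case 0
    show ?case using P0 P1 adj unfolding c_def by (intro exI[of _ F0] exI[of _ G0] exI[of _ F1] exI[of _ G1]) auto
  next
    case (Suc n)
    then obtain F G F' G' where IH: "pole_pair F G" "pole_pair F' G'" "adjacent A B F' G' F G"
     "int (degree F') - int (degree F) \<le> 2 * int n + 1 + c"
     "int (degree F) \<le> int n ^ 2 + c * int n + int (degree F0)" by blast
    obtain F'' G'' where st: "pole_pair F'' G''" "adjacent A B F'' G'' F' G'" "degree F'' + degree F \<le> 2 * degree F' + 2"
      using adjacent_step[OF IH(2,1,3)] .
    have "int (degree F') \<le> int (Suc n)^2 + c * int (Suc n) + int (degree F0)"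
      using IH(4,5) by (simp add: power2_eq_square algebra_simps)
    moreover have "int (degree F'') - int (degree F') \<le> 2 * int (Suc n) + 1 + c"
      using IH(4) st(3) by simp
    ultimately show ?case using IH(2) st by blast
  qed
  then show ?thesis by (meson of_nat_0_le_iff order_trans)
qed


section \<open>Hasse's bound for short Weierstrass equations\<close>

lemma prod_linear_factors_dvd:
  fixes P :: "'a::field poly"
  assumes "finite S" "\<And>x. x \<in> S \<Longrightarrow> poly P x = 0"
  shows "(\<Prod>x\<in>S. [:-x, 1:]) dvd P"
  using assms
proof (induction S arbitrary: P rule: finite_induct)
  case (insert x S)
  then obtain R where R: "P = [:-x, 1:] * R" by (metis insertI1 poly_eq_0_iff_dvd dvdE)
  have "poly R y = 0" if "y \<in> S" for y
    using that insert.hyps insert.prems[of y] R by auto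
  then have "(\<Prod>x\<in>S. [:-x, 1:]) dvd R" by (rule insert.IH)
  then show ?case using insert.hyps R by (simp add: mult_dvd_mono del: mult_pCons_left)
qed simp

lemma degree_prod_linear_factors: "degree (\<Prod>x\<in>S. [:-x, 1:] :: 'a::field poly) = card S"
  by (subst degree_prod_eq_sum_degree) auto

lemma euler_criterion_mod_ring:
  fixes v :: "'a::prime_card mod_ring"
  assumes "CARD('a) > 2" "v \<noteq> 0"
  shows "v ^ ((CARD('a) - 1) div 2) = (if \<exists>y. y^2 = v then 1 else -1)"
proof -
  let ?p = "CARD('a)"
  obtain k where k: "v = of_int (int k)"
    using surj_of_nat_mod_ring[of v] by auto
  have sq: "(\<exists>y. y^2 = v) \<longleftrightarrow> QuadRes ?p (int k)"
  proof
    assume "\<exists>y. y^2 = v"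
    then obtain i where "(of_int (int i))^2 = v"
      using surj_of_nat_mod_ring by (metis of_int_of_nat_eq)
    then have "of_int ((int i)^2) = (of_int (int k) :: 'a mod_ring)" using k by simp
    then show "QuadRes ?p (int k)"
      unfolding QuadRes_def of_int_eq_iff_cong_CHAR by auto
  next
    assume "QuadRes ?p (int k)"
    then obtain y where "[y^2 = int k] (mod int ?p)" unfolding QuadRes_def by auto
    then have "of_int (y^2) = (of_int (int k) :: 'a mod_ring)"
      unfolding of_int_eq_iff_cong_CHAR by simp
    then show "\<exists>y. y^2 = v" using k by (metis of_int_power)
  qed
  have nz: "\<not> [int k = 0] (mod int ?p)"
    using assms(2) k of_int_eq_iff_cong_CHAR[of "int k" 0, where 'a = "'a mod_ring"] by simp
  have "[Legendre (int k) ?p = int k ^ ((?p - 1) div 2)] (mod int ?p)"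
    using euler_criterion[of ?p "int k"] assms(1) prime_card[where 'a = 'a] by simp
  then have "of_int (Legendre (int k) ?p) = (of_int (int k ^ ((?p - 1) div 2)) :: 'a mod_ring)"
    unfolding of_int_eq_iff_cong_CHAR by simp
  then show ?thesis
    using sq nz k by (auto simp: Legendre_def)
qed

lemma two_neq_zero_mod_ring:
  assumes "CARD('a::prime_card) > 2"
  shows "(2 :: 'a mod_ring) \<noteq> 0"
  using of_nat_0_mod_ring_dvd[of 2, where 'a = 'a] assms dvd_imp_le[of "CARD('a)" 2] by auto

lemma cubic_frobenius:
  fixes A B :: "'a::prime_card mod_ring"
  defines "q \<equiv> CARD('a)" 
  shows "([:0,1:]^3 + [:A:] * [:0,1:] + [:B:]) ^ q = ([:0,1:]^q)^3 + [:A:] * [:0,1:]^q + [:B:]"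
proof -
  have ch: "CHAR('a mod_ring poly) = q" by (simp add: q_def)
  have pr: "prime CHAR('a mod_ring poly)" using prime_card[where 'a = 'a] by simp
  have add: "(x + y) ^ q = x ^ q + y ^ q" for x y :: "'a mod_ring poly"
    using freshmans_dream[OF pr ch[symmetric], of x y] .
  have const: "[:c:] ^ q = [:c:]" for c :: "'a mod_ring"
    using finite_field_power_card_eq_same[of c] by (simp add: poly_const_pow q_def)
  show ?thesis
    by (simp only: add power_mult_distrib const) (simp only: power_commutes flip: power_mult, simp add: mult.commute)
qed

text \<open>
  The second member of the chain: the $x$-coordinate of $(t^q, h) - (t, e)$, where
  $h = f(t)^{(q-1)/2}$, is
  \[\frac{f(t) (h + e)^2 - (t^q + t) (t^q - t)^2}{(t^q - t)^2},\]
  whose numerator has degree $2 q + 1$. The number of points enters through cancellation: the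
  denominator is the square of the product of all $t - \alpha$ with
  $\alpha \in \mathbb{F}_q$, and the numerator is divisible by $(t - \alpha)^2$ if
  $f(\alpha)^{(q-1)/2} = -e$ and by $t - \alpha$ if $f(\alpha) = 0$.
\<close>

lemma start_of_chain:
  fixes A B e :: "'a::prime_card mod_ring"
  defines "q \<equiv> CARD('a)"
  defines "f \<equiv> \<lambda>x. x^3 + A * x + B"
  assumes q: "q > 2" and e: "e = 1 \<or> e = -1"
  obtains F G where "pole_pair F G" "adjacent A B F G ([:0,1:]^q) 1"
    "degree F \<le> 1 + 2 * card {x. f x ^ ((q - 1) div 2) = e} + card {x. f x = 0}"
proof -
  have "odd q" using q prime_card[where 'a = 'a] prime_odd_nat unfolding q_def by blast
  then obtain m where m: "q = 2 * m + 1" by (elim oddE)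
  then have m1: "m \<ge> 1" and mdiv: "(q - 1) div 2 = m" using q by auto
  have e2: "e^2 = 1" using e by auto
  have two: "(2::'a mod_ring) \<noteq> 0" by (rule two_neq_zero_mod_ring) (use q in \<open>simp add: q_def\<close>)
  have ene: "e \<noteq> -e" using e two
    by (metis add.inverse_inverse add_eq_0_iff one_add_one)
  define t where "t = ([:0,1:] :: 'a mod_ring poly)"
  define T where "T = t ^ q"
  define a b where "a = [:A:]" and "b = [:B:]"
  define P where "P = t^3 + a * t + b"
  define h where "h = P ^ m"
  define D where "D = T - t"
  define num where "num = P * (h + [:e:])^2 - (T + t) * D^2"
  (* (T, h) lies on the twisted curve P y^2 = x^3 + a x + b, by the Frobenius map. *)
  have frob: "P * h^2 = T^3 + a * T + b"
  proof -
    have "P * h^2 = P ^ q" by (simp add: h_def m power_mult mult.commute flip: power_Suc2 power_mult)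
    then show ?thesis
      unfolding P_def T_def t_def a_def b_def q_def using cubic_frobenius[of A B] by simp
  qed
  have const2: "[:e:]^2 = 1" using e2 by (simp add: poly_const_pow one_pCons)
  (* The cubes of T cancel, which leaves T^2 t as the term of highest degree. *)
  have num: "num = (T + t) * (T * t + a) + 2 * b + 2 * [:e:] * h * P"
  proof -
    have "num = P * h^2 + 2 * [:e:] * h * P + P * [:e:]^2 - (T + t) * (T - t)^2"
      unfolding num_def D_def by (simp add: algebra_simps power2_eq_square)
    also have "\<dots> = (T + t) * (T * t + a) + 2 * b + 2 * [:e:] * h * P"
      unfolding frob const2 by (simp add: P_def algebra_simps power2_eq_square power3_eq_cube)
    finally show ?thesis .
  qed
  have polyP: "poly P x = f x" for x
    by (simp add: P_def t_def a_def b_def f_def)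
  have degP: "degree P \<le> 3"
    unfolding P_def t_def a_def b_def
    by (intro degree_add_le) (simp_all add: degree_power_eq)
  have degT: "degree T = q" by (simp add: T_def t_def degree_power_eq)
  have T0: "T \<noteq> 0" using degT q by auto
  have degD: "degree D = q"
    unfolding D_def diff_conv_add_uminus using q degT by (subst degree_add_eq_left) (auto simp: t_def)
  have D0: "D \<noteq> 0" using degD q by auto
  have deg_num: "degree num = 2 * q + 1"
  proof -
    define R where "R = T * t^2 + a * (T + t) + 2 * b + 2 * [:e:] * h * P"
    have eq: "num = T^2 * t + R"
      unfolding num R_def by (simp add: algebra_simps power2_eq_square)
    have lead: "degree (T^2 * t) = 2 * q + 1"
      using T0 degT by (simp add: degree_mult_eq degree_power_eq t_def)
    have "degree (T * t^2) \<le> 2 * q"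
      using degree_mult_le[of T "t^2"] degT q by (simp add: degree_power_eq t_def)
    moreover have "degree (a * (T + t)) \<le> 2 * q"
    proof -
      have "degree (T + t) \<le> q" using degT q by (intro degree_add_le) (auto simp: t_def)
      then show ?thesis unfolding a_def using degree_smult_le[of A "T + t"] by simp
    qed
    moreover have "degree (2 * b) \<le> 2 * q" by (simp add: b_def numeral_poly)
    moreover have "degree (2 * [:e:] * h * P) \<le> 2 * q"
    proof -
      have "degree h \<le> 3 * m" 
        unfolding h_def using degree_power_le[of P m] degP by (meson le_trans mult_le_mono1)
      then have "degree (h * P) \<le> 3 * m + 3" using degree_mult_le[of h P] degP by linarith
      then have "degree (h * P) \<le> 2 * q" using m m1 by linarith
      moreover have "2 * [:e:] * h * P = Polynomial.smult (2 * e) (h * P)"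
        by (simp add: numeral_poly mult_ac)
      ultimately show ?thesis using degree_smult_le[of "2 * e" "h * P"] by simp
    qed
    ultimately have "degree R \<le> 2 * q" unfolding R_def by (intro degree_add_le)
    then show ?thesis using eq lead by (simp add: degree_add_eq_left)
  qed
  have num0: "num \<noteq> 0" using deg_num by auto
  have "degree (D^2) < degree num" using deg_num degD D0 by (simp add: degree_power_eq)
  then obtain g F G where red: "num = g * F" "D^2 = g * G" "g \<noteq> 0" "pole_pair F G"
      "\<And>c. c dvd num \<Longrightarrow> c dvd D^2 \<Longrightarrow> degree F + degree c \<le> degree num"
    using reduce_pair[OF num0, of "D^2"] by metis
  have "adjacent A B T 1 num (D^2)"
  proof -
    (* The discriminant of the quadratic is 16 P (T^3 + a T + b) = (4 P h)^2, so that
       V / 2 + 2 e h P, which is num, is D^2 times one of its roots. *)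
    define V where "V = quad_mid a b t T 1"
    have V: "V = 2 * ((T + t) * (T * t + a) + 2 * b)" by (simp add: V_def quad_mid_def)
    have num': "2 * num = V + 4 * [:e:] * h * P" by (simp add: V num mult.assoc)
    have WU: "quad_lead t T 1 * quad_const a b t T 1 * 4 = V^2 - 16 * (T^3 + a * T + b) * P"
      unfolding V P_def quad_lead_def quad_const_def by (simp add: algebra_simps power2_eq_square power3_eq_cube)
    have W: "quad_lead t T 1 = D^2" by (simp add: quad_lead_def D_def)
    have "4 * (num^2 - V * num + D^2 * quad_const a b t T 1) = (2 * num - V)^2 - V^2 + quad_lead t T 1 * quad_const a b t T 1 * 4"
      unfolding W by (simp add: algebra_simps power2_eq_square)
    also have "\<dots> = 16 * P * ([:e:]^2 * (P * h^2)) - 16 * (T^3 + a * T + b) * P"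
      unfolding WU num' by (simp add: algebra_simps power2_eq_square)
    also have "\<dots> = 0" unfolding const2 frob by (simp add: algebra_simps)
    finally have "4 * (num^2 - V * num + D^2 * quad_const a b t T 1) = 0" .
    moreover have "(4 :: 'a mod_ring poly) \<noteq> 0"
    proof -
      have "(4 :: 'a mod_ring) = 2 * 2" by simp
      then have "(4 :: 'a mod_ring) \<noteq> 0" using two by (metis mult_eq_0_iff)
      then show ?thesis by (simp add: numeral_poly)
    qed
    ultimately have *: "num^2 - V * num + D^2 * quad_const a b t T 1 = 0"
      by (metis mult_eq_0_iff)
    have "adjacent A B T 1 num (D^2) \<longleftrightarrow> D^2 * (num^2 - V * num + D^2 * quad_const a b t T 1) = 0"
      unfolding adjacent_def W[unfolded t_def] V_def a_def[symmetric] b_def[symmetric] t_def[symmetric] W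
      by (simp add: algebra_simps power2_eq_square)
    then show ?thesis using * by simp
  qed
  then have adj: "adjacent A B F G ([:0,1:]^q) 1"
    using red adjacent_scale adjacent_sym unfolding T_def t_def by metis
  define S Z Y where "S = {x. f x ^ m = -e}" and "Z = {x. f x = 0}" and "Y = {x. f x ^ m = e}"
  have part: "card S + card Z + card Y = q"
  proof -
    have "v ^ m = 1 \<or> v ^ m = -1" if "v \<noteq> 0" for v :: "'a mod_ring"
      using euler_criterion_mod_ring[of v] that q mdiv unfolding q_def by auto
    then have *: "f x = 0 \<or> f x ^ m = 1 \<or> f x ^ m = -1" for x by blast
    have "x \<in> S \<union> Z \<union> Y" for x
      using *[of x] e unfolding S_def Z_def Y_def by auto
    then have "S \<union> Z \<union> Y = UNIV" by blast
    moreover have "S \<inter> Z = {}" "(S \<union> Z) \<inter> Y = {}"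
      using e m1 ene by (auto simp: S_def Z_def Y_def power_0_left)
    ultimately have "card (UNIV :: 'a mod_ring set) = card S + card Z + card Y"
      by (metis card_Un_disjoint finite)
    then show ?thesis by (simp add: q_def)
  qed
  (* The factors that cancel at least, by the values of f at the elements of the field. *)
  define c where "c = (\<Prod>x\<in>S. [:-x,1:])^2 * (\<Prod>x\<in>Z. [:-x,1:])"
  have degc: "degree c = 2 * card S + card Z"
    unfolding c_def by (subst degree_mult_eq) (auto simp: degree_power_eq degree_prod_linear_factors)
  have polyD: "poly D x = 0" for x
    using finite_field_power_card_eq_same[of x] by (simp add: D_def T_def t_def q_def)
  have cD: "c dvd D^2"
  proof -
    have disj: "S \<inter> Z = {}" using e m1 by (auto simp: S_def Z_def power_0_left)
    have "(\<Prod>x\<in>S \<union> Z. [:-x,1:]) dvd D" by (rule prod_linear_factors_dvd) (auto simp: polyD)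
    then have "((\<Prod>x\<in>S. [:-x,1:]) * (\<Prod>x\<in>Z. [:-x,1:]))^2 dvd D^2"
      using disj by (simp add: prod.union_disjoint dvd_power_same)
    moreover have "c dvd ((\<Prod>x\<in>S. [:-x,1:]) * (\<Prod>x\<in>Z. [:-x,1:]))^2"
      unfolding c_def by (simp add: power_mult_distrib power2_eq_square)
    ultimately show ?thesis using dvd_trans by blast
  qed
  have "c dvd P * (h + [:e:])^2"
  proof -
    have "(\<Prod>x\<in>S. [:-x,1:]) dvd h + [:e:]"
      by (rule prod_linear_factors_dvd) (auto simp: S_def h_def polyP)
    moreover have "(\<Prod>x\<in>Z. [:-x,1:]) dvd P"
      by (rule prod_linear_factors_dvd) (auto simp: Z_def polyP)
    ultimately show ?thesis unfolding c_def by (metis mult.commute mult_dvd_mono dvd_power_same)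
  qed
  then have "c dvd num" unfolding num_def using cD by (simp add: dvd_diff dvd_mult)
  then have "degree F + degree c \<le> 2 * q + 1" using red(5) cD deg_num by simp
  then have "degree F \<le> 1 + 2 * card Y + card Z" using degc part by linarith
  then have "degree F \<le> 1 + 2 * card {x. f x ^ ((q - 1) div 2) = e} + card {x. f x = 0}"
    unfolding mdiv Y_def Z_def .
  then show ?thesis by (rule that[OF red(4) adj])
qed

text \<open>
  The polynomial is evaluated at an integer next to its minimum $-a/2$.
\<close>

lemma quadratic_bound:
  fixes a c :: int
  assumes "\<And>n. 0 \<le> n^2 + a * n + c"
  shows "a^2 \<le> 4 * c + 1"
proof -
  define k r where "k = a div 2" and "r = a mod 2"
  have a: "a = 2 * k + r" and r: "r = 0 \<or> r = 1" by (auto simp: k_def r_def)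
  have "0 \<le> (-k)^2 + a * (-k) + c" by (rule assms)
  then show ?thesis using r unfolding a by (auto simp: power2_eq_square algebra_simps)
qed

lemma card_square_roots:
  fixes v :: "'a::prime_card mod_ring"
  assumes "CARD('a) > 2"
  shows "card {y. y^2 = v} = (if v = 0 then 1 else if v ^ ((CARD('a) - 1) div 2) = 1 then 2 else 0)"
proof (cases "\<exists>w. w^2 = v")
  case True
  then obtain w where w: "w^2 = v" by blast
  have two: "(2::'a mod_ring) \<noteq> 0" by (rule two_neq_zero_mod_ring) (rule assms)
  have eq: "{y. y^2 = v} = {w, -w}" using w power2_eq_iff by auto
  show ?thesis
  proof (cases "v = 0")
    case False
    then have "w \<noteq> 0" using w by auto
    then have "w \<noteq> -w" using two by (metis add_eq_0_iff mult_2 mult_eq_0_iff)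
    then show ?thesis using False eq euler_criterion_mod_ring[OF assms, of v] True by simp
  qed (use eq w in auto)
next
  case False
  have two: "(2::'a mod_ring) \<noteq> 0" by (rule two_neq_zero_mod_ring) (rule assms)
  have "v \<noteq> 0" using False by (metis zero_power2)
  moreover have "(-1::'a mod_ring) \<noteq> 1" using two by (metis add.inverse_inverse add_eq_0_iff one_add_one)
  ultimately show ?thesis using False euler_criterion_mod_ring[OF assms, of v] by auto
qed

text \<open>
  The two signs $e = 1$ and $e = -1$ give chains that start with the slopes $-a$ and $a$
  and so control the polynomial $n^2 + a n + q$ at negative and at nonnegative $n$.
  The bound $a^2 \le 4 q + 1$ differs from Hasse's $a^2 \le 4 q$ only in the value
  $a^2 = 4 q + 1$.
\<close>

theorem hasse_short_weierstrass:
  fixes A B :: "'a::prime_card mod_ring"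
  assumes q: "CARD('a) > 2"
  shows "(int CARD('a) - int (card {(x, y). y^2 = x^3 + A * x + B}))^2 \<le> 4 * int CARD('a) + 1"
proof -
  define q where "q = CARD('a)"
  define m where "m = (q - 1) div 2"
  define f where "f = (\<lambda>x. x^3 + A * x + B)"
  define Z where "Z = card {x. f x = 0}"
  define Y where "Y = (\<lambda>e. card {x. f x ^ m = e})"
  define N where "N = card {(x, y). y^2 = f x}"
  have two: "(2::'a mod_ring) \<noteq> 0" by (rule two_neq_zero_mod_ring) (rule assms)
  have one: "(1::'a mod_ring) \<noteq> -1" using two by (metis add.inverse_inverse add_eq_0_iff one_add_one)
  have m1: "m > 0" using assms by (simp add: m_def q_def)
  have N: "N = Z + 2 * Y 1"
  proof -
    have "{(x, y). y^2 = f x} = Sigma UNIV (\<lambda>x. {y. y^2 = f x})" by auto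
    then have "N = (\<Sum>x\<in>UNIV. card {y. y^2 = f x})" by (simp add: N_def)
    also have "\<dots> = (\<Sum>x\<in>UNIV. (if f x = 0 then 1 else 0) + (if f x ^ m = 1 then 2 else 0))"
      using m1 card_square_roots[OF assms, folded q_def, folded m_def]
      by (intro sum.cong) (auto simp: power_0_left)
    also have "\<dots> = Z + 2 * Y 1"
      by (simp add: sum.distrib Z_def Y_def sum.If_cases)
    finally show ?thesis .
  qed
  have part: "Z + Y 1 + Y (-1) = q"
  proof -
    have "v ^ m = 1 \<or> v ^ m = -1" if "v \<noteq> 0" for v :: "'a mod_ring"
      using euler_criterion_mod_ring[OF assms, of v] that unfolding m_def q_def by auto
    then have "{x. f x = 0} \<union> {x. f x ^ m = 1} \<union> {x. f x ^ m = -1} = UNIV" by auto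
    moreover have "{x. f x = 0} \<inter> {x. f x ^ m = 1} = {}"
      "({x. f x = 0} \<union> {x. f x ^ m = 1}) \<inter> {x. f x ^ m = -1} = {}"
      using m1 one by (auto simp: power_0_left)
    ultimately have "card (UNIV :: 'a mod_ring set) = Z + Y 1 + Y (-1)"
      unfolding Z_def Y_def by (metis card_Un_disjoint finite)
    then show ?thesis by (simp add: q_def)
  qed
  have start: "pole_pair ([:0,1:]^q) (1 :: 'a mod_ring poly)"
    using assms by (simp add: pole_pair_def degree_power_eq q_def)
  have chain: "0 \<le> int n^2 + (2 * int (Y e) + int Z - int q) * int n + int q" if e: "e = 1 \<or> e = -1" for n e
  proof -
    obtain F G where FG: "pole_pair F G" "adjacent A B F G ([:0,1:]^CARD('a)) 1"
      "degree F \<le> 1 + 2 * card {x. (x^3 + A * x + B) ^ ((CARD('a) - 1) div 2) = e}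
                     + card {x. x^3 + A * x + B = 0}"
      using start_of_chain[OF assms e, of A B] .
    have deg: "degree F \<le> 1 + 2 * Y e + Z"
      using FG(3) unfolding Y_def Z_def f_def m_def q_def .
    have adj: "adjacent A B F G ([:0,1:]^q) 1" using FG(2) unfolding q_def .
    have "0 \<le> int n^2 + (int (degree F) - int q - 1) * int n + int q"
      using adjacent_chain[OF start FG(1) adj, of n] by (simp add: degree_power_eq)
    also have "\<dots> \<le> int n^2 + (2 * int (Y e) + int Z - int q) * int n + int q"
      using deg by (intro add_mono mult_right_mono) auto
    finally show ?thesis .
  qed
  define a where "a = int q - int N"
  have "0 \<le> n^2 + a * n + int q" for n :: int
  proof (cases "n \<ge> 0")
    case True
    have "2 * int (Y (-1)) + int Z - int q = a" using part N by (simp add: a_def)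
    then show ?thesis using chain[of "-1" "nat n"] True by simp
  next
    case False
    have "2 * int (Y 1) + int Z - int q = -a" using N by (simp add: a_def)
    then show ?thesis using chain[of 1 "nat (-n)"] False by simp
  qed
  then have "a^2 \<le> 4 * int q + 1" by (rule quadratic_bound)
  then show ?thesis by (simp add: a_def N_def f_def q_def)
qed


section \<open>Hasse's bound for the trace of Frobenius\<close>

text \<open>
  Completing the square and the cube; $h$ and $k$ in the proof are the inverses of 2 and 3.
\<close>

lemma short_weierstrass_form:
  fixes W :: "'a::field weierstrass"
  assumes "(2::'a) \<noteq> 0" "(3::'a) \<noteq> 0"
  obtains A B :: 'a where
    "card {(x, y). weierstrass_poly W x y = 0} = card {(x, y). y^2 = x^3 + A * x + B}"
proof -
  obtain a1 a2 a3 a4 a6 where W: "W = Weierstrass a1 a2 a3 a4 a6" by (cases W)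
  obtain h k :: 'a where h: "2 * h = 1" and k: "3 * k = 1"
    using assms by (metis right_inverse)
  define \<alpha> \<beta> \<gamma> where "\<alpha> = a2 + (a1 * h)^2" and "\<beta> = a4 + a1 * a3 * h" and "\<gamma> = a6 + (a3 * h)^2"
  define A B where "A = \<beta> - \<alpha>^2 * k" and "B = \<gamma> - \<alpha> * \<beta> * k + 2 * \<alpha>^3 * k^3"
  define \<phi> where "\<phi> = (\<lambda>(x, y). (x + \<alpha> * k, y + (a1 * x + a3) * h))"
  define \<psi> where "\<psi> = (\<lambda>(x, y). (x - \<alpha> * k, y - (a1 * (x - \<alpha> * k) + a3) * h))"
  have sq: "weierstrass_poly W x y = (y + (a1 * x + a3) * h)^2 - (x^3 + \<alpha> * x^2 + \<beta> * x + \<gamma>)" for x y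
  proof -
    have "(y + (a1 * x + a3) * h)^2 = y^2 + (2 * h) * (a1 * x + a3) * y + (a1 * h)^2 * x^2 + (2 * h) * (a1 * a3 * h) * x + (a3 * h)^2"
      by (simp add: algebra_simps power2_eq_square)
    then show ?thesis
      unfolding h by (simp add: W weierstrass_poly_def \<alpha>_def \<beta>_def \<gamma>_def algebra_simps)
  qed
  have cube: "x^3 + \<alpha> * x^2 + \<beta> * x + \<gamma> = (x + \<alpha> * k)^3 + A * (x + \<alpha> * k) + B" for x
    using k unfolding A_def B_def by Groebner_Basis.algebra
  let ?S = "{(x, y). weierstrass_poly W x y = 0}" and ?S' = "{(x, y). y^2 = x^3 + A * x + B}"
  have inv: "\<psi> (\<phi> z) = z" "\<phi> (\<psi> z) = z" for z
    by (simp_all add: \<phi>_def \<psi>_def split: prod.split)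
  have mem: "z \<in> ?S \<longleftrightarrow> \<phi> z \<in> ?S'" for z
    by (cases z) (simp only: \<phi>_def case_prod_conv mem_Collect_eq sq cube right_minus_eq)
  have "bij_betw \<phi> ?S ?S'"
  proof (rule bij_betw_byWitness[where f' = \<psi>])
    show "\<psi> ` ?S' \<subseteq> ?S"
    proof
      fix w assume "w \<in> \<psi> ` ?S'"
      then obtain z where "w = \<psi> z" "z \<in> ?S'" by blast
      then show "w \<in> ?S" using mem[of w] inv(2)[of z] by (simp only:)
    qed
    show "\<phi> ` ?S \<subseteq> ?S'"
    proof
      fix w assume "w \<in> \<phi> ` ?S"
      then obtain z where "w = \<phi> z" "z \<in> ?S" by blast
      then show "w \<in> ?S'" using mem[of z] by (simp only:)
    qed
  qed (rule ballI, rule inv)+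
  from that[OF bij_betw_same_card[OF this]] show ?thesis .
qed

lemma card_affine_points_mod_ring:
  assumes "CARD('a::prime_card) = p"
  shows "card (affine_points E p) =
    card {(x, y :: 'a mod_ring). weierstrass_poly (map_weierstrass of_int E) x y = 0}"
proof -
  obtain a1 a2 a3 a4 a6 where E: "E = Weierstrass a1 a2 a3 a4 a6" by (cases E)
  let ?i = "of_int :: int \<Rightarrow> 'a mod_ring"
  have poly: "weierstrass_poly (map_weierstrass ?i E) (?i x) (?i y) = ?i (weierstrass_poly E x y)" for x y
    by (simp add: E weierstrass_poly_def)
  have zero: "?i z = 0 \<longleftrightarrow> [z = 0] (mod int p)" for z
    using of_int_eq_iff_cong_CHAR[of z 0, where 'a = "'a mod_ring"] assms by simp
  have inj: "x = x'" if "x \<in> {0..<int p}" "x' \<in> {0..<int p}" "?i x = ?i x'" for x x'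
    using that assms by (auto simp: of_int_eq_iff_cong_CHAR cong_def)
  have surj: "\<exists>z\<in>{0..<int p}. x = ?i z" for x
    using surj_of_nat_mod_ring[of x] assms by (metis atLeastLessThan_iff of_int_of_nat_eq of_nat_0_le_iff of_nat_less_iff)
  have "bij_betw (map_prod ?i ?i) (affine_points E p)
    {(x, y). weierstrass_poly (map_weierstrass of_int E) x y = 0}"
    unfolding bij_betw_def
  proof
    show "inj_on (map_prod ?i ?i) (affine_points E p)"
      using inj by (auto simp: inj_on_def affine_points_def)
    show "map_prod ?i ?i ` affine_points E p = {(x, y). weierstrass_poly (map_weierstrass of_int E) x y = 0}"
    proof (intro equalityI subsetI)
      fix z assume "z \<in> {(x, y). weierstrass_poly (map_weierstrass ?i E) x y = 0}"
      moreover obtain x y where "z = (?i x, ?i y)" "x \<in> {0..<int p}" "y \<in> {0..<int p}"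
        using surj[of "fst z"] surj[of "snd z"] by (metis prod.collapse)
      ultimately have "z = (?i x, ?i y)" "x \<in> {0..<int p}" "y \<in> {0..<int p}"
        "weierstrass_poly (map_weierstrass ?i E) (?i x) (?i y) = 0" by auto
      then show "z \<in> map_prod ?i ?i ` affine_points E p"
        unfolding poly zero by (force simp: affine_points_def image_iff)
    qed (auto simp: affine_points_def poly zero)
  qed
  then show ?thesis by (rule bij_betw_same_card)
qed

lemma frobenius_trace_bound_if_CARD:
  assumes "CARD('a::prime_card) = p" "p > 3"
  shows "(frobenius_trace E p)^2 \<le> 4 * int p + 1"
proof -
  have two: "(2::'a mod_ring) \<noteq> 0" by (rule two_neq_zero_mod_ring) (use assms in simp)
  have three: "(3::'a mod_ring) \<noteq> 0"
    using of_nat_0_mod_ring_dvd[of 3, where 'a = 'a] assms dvd_imp_le[of p 3] by auto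
  obtain A B :: "'a mod_ring" where "card {(x, y :: 'a mod_ring). weierstrass_poly (map_weierstrass of_int E) x y = 0}
      = card {(x, y). y^2 = x^3 + A * x + B}"
    using short_weierstrass_form[OF two three] .
  then have "card (affine_points E p) = card {(x, y). y^2 = x^3 + A * x + B}"
    using card_affine_points_mod_ring[OF assms(1)] by simp
  then have trace: "frobenius_trace E p = int p - int (card {(x, y). y^2 = x^3 + A * x + B})"
    by (simp add: frobenius_trace_def num_points_def)
  have "CARD('a) > 2" using assms by simp
  from hasse_short_weierstrass[OF this, of A B] show ?thesis
    unfolding trace assms(1) .
qed

text \<open>
  The bound so far concerns a prime that is the cardinality of a type, whereas $p$ is an arbitrary
  number. It suffices to have one type, of cardinality a prime that is a counterexample to the bound
  if there are any counterexamples: as the bound holds for this prime, it holds for all. The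
  prime is chosen with the choice operator, and the type consists of its residues.
\<close>

definition hasse_bound :: "nat \<Rightarrow> bool" where
  "hasse_bound p \<longleftrightarrow> (\<forall>E. (frobenius_trace E p)^2 \<le> 4 * int p + 1)"

definition critical_prime :: nat where
  "critical_prime = (SOME p. prime p \<and> p > 3 \<and> (hasse_bound p \<longrightarrow> (\<forall>p. prime p \<longrightarrow> p > 3 \<longrightarrow> hasse_bound p)))"

lemma critical_prime:
  "prime critical_prime" "critical_prime > 3"
  "hasse_bound critical_prime \<Longrightarrow> prime p \<Longrightarrow> p > 3 \<Longrightarrow> hasse_bound p"
proof -
  have "prime (5::nat)" by simp
  then have "\<exists>p::nat. prime p \<and> p > 3 \<and> (hasse_bound p \<longrightarrow> (\<forall>p. prime p \<longrightarrow> p > 3 \<longrightarrow> hasse_bound p))"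
    by (cases "\<forall>p. prime p \<longrightarrow> p > 3 \<longrightarrow> hasse_bound p") (auto intro: exI[of _ 5])
  from someI_ex[OF this, folded critical_prime_def]
  show "prime critical_prime" "critical_prime > 3"
    "hasse_bound critical_prime \<Longrightarrow> prime p \<Longrightarrow> p > 3 \<Longrightarrow> hasse_bound p" by auto
qed

typedef critical_index = "{..<critical_prime}"
  using critical_prime(2) by (intro exI[of _ 0]) auto

lemma CARD_critical_index: "CARD(critical_index) = critical_prime"
  using type_definition.card[OF type_definition_critical_index] by simp

instance critical_index :: prime_card
  by standard (simp add: CARD_critical_index critical_prime(1))

theorem frobenius_trace_bound:
  assumes "prime p" "p > 3"
  shows "(frobenius_trace E p)^2 \<le> 4 * int p + 1"
proof -
  have "hasse_bound critical_prime"
    unfolding hasse_bound_def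
    by (intro allI frobenius_trace_bound_if_CARD[OF CARD_critical_index critical_prime(2)])
  from critical_prime(3)[OF this assms] show ?thesis
    unfolding hasse_bound_def by (rule spec)
qed

section \<open>Elliptic Korselt numbers with two prime factors\<close>

lemma prime_gt_3_if_coprime_6:
  assumes "prime p" "p dvd n" "coprime n 2" "coprime n (3::nat)"
  shows "p > 3"
proof -
  have "coprime p 2" "coprime p 3" using assms by (meson coprime_divisors dvd_refl)+
  then have "p \<noteq> 2" "p \<noteq> 3" by auto
  then show ?thesis using prime_ge_2_nat[OF assms(1)] by linarith
qed

lemma abs_le_if_sq_le:
  fixes a q :: int
  assumes "a^2 \<le> 4 * q + 1" "q \<ge> 5"
  shows "\<bar>a\<bar> \<le> q"
proof -
  have "4 * q + 1 \<le> q^2"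
  proof -
    have "5 * q \<le> q * q" using assms(2) by (intro mult_right_mono) auto
    then show ?thesis using assms(2) unfolding power2_eq_square by linarith
  qed
  then have "a^2 \<le> q^2" using assms(1) by linarith
  then have "\<bar>a\<bar> \<le> \<bar>q\<bar>" by (simp only: abs_le_square_iff)
  then show ?thesis using assms(2) by linarith
qed

text \<open>
  The left-hand side bounds $|a_q (p - a_p) - (p - 1)| + a_q$, and the right-hand side is
  $N_q + a_q$, so a number of that absolute value which is divisible by $N_q$ vanishes. The
  assumption $256 p^2 < q$ is the negation of $p \ge \sqrt q / 16$. Crudely,
  $((2 p + 1) |a|)^2 \le 45 p^2 q < q^2 / 4$, while $q + 1 - p \ge q / 2$.
\<close>

lemma small_multiple_of_num_points:
  fixes a p q :: int
  assumes a: "a^2 \<le> 4 * q + 1" and p: "p \<ge> 5" and q: "256 * p^2 < q"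
  shows "(2 * p + 1) * \<bar>a\<bar> + p < q + 1"
proof (rule ccontr)
  assume "\<not> ?thesis"
  then have l: "q + 1 - p \<le> (2 * p + 1) * \<bar>a\<bar>" by linarith
  have "p * 1 \<le> p * p" using p by (intro mult_left_mono) auto
  then have pq: "256 * p < q" using q by (simp add: power2_eq_square)
  then have "(q + 1 - p)^2 \<le> ((2 * p + 1) * \<bar>a\<bar>)^2" using l p by (intro power_mono) auto
  also have "\<dots> = (2 * p + 1)^2 * a^2" by (simp add: power_mult_distrib)
  also have "\<dots> \<le> (3 * p)^2 * (5 * q)"
    using a p pq by (intro mult_mono power_mono) auto
  also have "\<dots> = 45 * p^2 * q" by (simp add: power2_eq_square)
  finally have 1: "(q + 1 - p)^2 \<le> 45 * p^2 * q" by simp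
  have "q * (4 * (45 * p^2)) < q * q" using q pq p by (intro mult_strict_left_mono) auto
  then have 2: "4 * (45 * p^2 * q) < q^2" by (simp add: power2_eq_square mult_ac)
  have "2 * p \<le> q" using pq p by linarith
  then have "q \<le> 2 * (q + 1 - p)" by simp
  then have "q^2 \<le> (2 * (q + 1 - p))^2" using pq p by (intro power_mono) auto
  then have "q^2 \<le> 4 * (q + 1 - p)^2" unfolding power_mult_distrib by simp
  then show False using 1 2 by linarith
qed

theorem corollary2p7:
  fixes E :: "int weierstrass" and n p q :: nat
  assumes "minimal_elliptic_curve E"
    and "prime p" and "prime q" and "p < q" and "n = p * q"
    and "coprime n 2" and "coprime n 3"
    and "elliptic_korselt_type_I E n"
  shows "p \<le> 13 \<or> (anomalous E p \<and> anomalous E q) \<or> real p \<ge> sqrt (real q) / 16"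
proof -
  define a b where "a = frobenius_trace E p" and "b = frobenius_trace E q"
  have p3: "p > 3" and q3: "q > 3"
    using prime_gt_3_if_coprime_6[of _ n] assms by auto
  have hp: "a^2 \<le> 4 * int p + 1" and hq: "b^2 \<le> 4 * int q + 1"
    unfolding a_def b_def using frobenius_trace_bound assms p3 q3 by blast+
  have good: "good_reduction E p" "good_reduction E q"
    and dvd: "(int q + 1 - b) dvd (int n + 1 - lseries_coeff E n)"
    using assms unfolding elliptic_korselt_type_I_def b_def by auto
  have "coprime p q" using assms by (simp add: primes_coprime)
  then have an: "lseries_coeff E n = a * b"
    using lseries_coeff_mult[of p q E] lseries_coeff_prime assms good p3 q3 by (simp add: a_def b_def)
  (* M is the residue of n + 1 - a_n modulo N_q that results from q = a_q - 1. *)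
  define M where "M = b * (int p - a) - (int p - 1)"
  have "int n + 1 - lseries_coeff E n = int p * (int q + 1 - b) + M"
    unfolding an M_def using assms(5) by (simp add: algebra_simps)
  then have dvdM: "(int q + 1 - b) dvd M" using dvd by (simp add: dvd_add_right_iff)
  have "anomalous E p \<and> anomalous E q" if p13: "p > 13" and "real p < sqrt (real q) / 16"
  proof -
    from that(2) have "(16 * real p)^2 < (sqrt (real q))^2" by (intro power_strict_mono) auto
    then have "real (256 * p^2) < real q" by (simp add: power_mult_distrib)
    then have "int (256 * p^2) < int q" by (simp only: of_nat_less_iff)
    then have q: "256 * (int p)^2 < int q" by simp
    have absa: "\<bar>a\<bar> \<le> int p" using abs_le_if_sq_le[OF hp] p13 by simp
    have bound: "(2 * int p + 1) * \<bar>b\<bar> + int p < int q + 1"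
      using small_multiple_of_num_points[OF hq _ q] p13 by simp
    have "\<bar>b * (int p - a)\<bar> \<le> \<bar>b\<bar> * (2 * int p)"
      unfolding abs_mult using absa by (intro mult_left_mono) auto
    then have "\<bar>M\<bar> \<le> 2 * int p * \<bar>b\<bar> + int p"
      using p13 unfolding M_def by (simp add: mult_ac abs_le_iff)
    then have "\<bar>M\<bar> < int q + 1 - b" using bound by (simp add: algebra_simps)
    then have M0: "M = 0" using dvd_imp_le_int[OF _ dvdM] by linarith
    then have eq: "b * (int p - a) = int p - 1" by (simp add: M_def)
    have b0: "b > 0" using mult_nonpos_nonneg[of b "int p - a"] eq absa p13 by linarith
    (* If b is at least 2, then a is at least (p + 1) / 2, beyond 2 sqrt p for p > 13. *)
    have "b = 1"
    proof (rule ccontr)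
      assume "b \<noteq> 1"
      then have "2 * (int p - a) \<le> b * (int p - a)" using b0 absa by (intro mult_right_mono) auto
      then have "int p + 1 \<le> 2 * a" unfolding eq by simp
      then have "(int p + 1)^2 \<le> (2 * a)^2" using p13 by (intro power_mono) auto
      then have "(int p + 1)^2 \<le> 16 * int p + 4" using hp by (simp add: power_mult_distrib)
      then have "int p * (int p - 14) \<le> 3" by (simp add: power2_eq_square algebra_simps)
      moreover have "p \<noteq> 14" using assms(2) prime_odd_nat[of p] p13 by auto
      then have "int p * 1 \<le> int p * (int p - 14)" using p13 by (intro mult_left_mono) auto
      ultimately show False using p13 by linarith
    qed
    moreover from this have "a = 1" using eq by simp
    ultimately show ?thesis
      using good by (simp add: anomalous_def a_def b_def frobenius_trace_def)
  qed
  then show ?thesis by (meson not_le)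
qed

end
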